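(* If $n\ge 2$, then there is a dense uncountable set of $\mathbf{x}\in\mathbb R^n$ such that $\mathbf{x}$ is $k$-singular for all $k\in\mathbb N$ but $\mathbf{x}$ is not algebraic.
   Context: For a polynomial $P\in\mathbb Z[X_1,\dots,X_n]$, $H(P)$ is the maximum of the absolute values of its coefficients and $\deg P$ is its total degree. Let $N(k,n)=\binom{k+n}{n}-1$. A vector $\mathbf{x}\in\mathbb R^n$ is $k$-singular if for every $\varepsilon>0$ there is $Q_0>0$ such that for all $Q>Q_0$ there exists a nonzero $P\in\mathbb Z[X_1,\dots,X_n]$ with $\deg P\le k$, $H(P)\le Q$ and $|P(\mathbf{x})|\le\varepsilon Q^{-N(k,n)}$. A vector $\mathbf{x}$ is $k$-algebraic if there is a nonzero $P\in\mathbb Z[X_1,\dots,X_n]$ with $P(\mathbf{x})=0$ and $\deg P=k$, and algebraic if it is $k$-algebraic for some $k$. *)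

theory Defs
  imports "HOL-Analysis.Analysis" "HOL-Library.Poly_Mapping"
begin

text \<open>
  The ring of integer polynomials in finitely many variables indexed by \<open>'n\<close>:
  a finitely supported map from exponent vectors to coefficients, with the
  convolution product of \<^theory>\<open>HOL-Library.Poly_Mapping\<close>.
\<close>

type_synonym 'n int_mpoly = "('n \<Rightarrow>\<^sub>0 nat) \<Rightarrow>\<^sub>0 int"

definition eval_mpoly :: "'n::finite int_mpoly \<Rightarrow> real ^ 'n \<Rightarrow> real" where
  "eval_mpoly P x =
     (\<Sum>m\<in>Poly_Mapping.keys P.
        of_int (Poly_Mapping.lookup P m) * (\<Prod>i\<in>UNIV. (x $ i) ^ Poly_Mapping.lookup m i))"

text \<open>The element 0 is inserted only to give the zero polynomial height and degree 0.\<close>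

definition height :: "'n::finite int_mpoly \<Rightarrow> int" where
  "height P = Max (insert 0 ((\<lambda>m. \<bar>Poly_Mapping.lookup P m\<bar>) ` Poly_Mapping.keys P))"

definition total_degree :: "'n::finite int_mpoly \<Rightarrow> nat" where
  "total_degree P =
     Max (insert 0 ((\<lambda>m. \<Sum>i\<in>UNIV. Poly_Mapping.lookup m i) ` Poly_Mapping.keys P))"

text \<open>The subtraction does not truncate, since the binomial coefficient is at least 1.\<close>

definition N :: "nat \<Rightarrow> nat \<Rightarrow> nat" where
  "N k n = ((k + n) choose n) - 1"

definition k_singular :: "nat \<Rightarrow> real ^ 'n::finite \<Rightarrow> bool" where
  "k_singular k x \<longleftrightarrow>
     (\<forall>\<epsilon>>0. \<exists>Q0>0. \<forall>Q::real. Q > Q0 \<longrightarrow>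
        (\<exists>P :: 'n int_mpoly. P \<noteq> 0 \<and> total_degree P \<le> k \<and> of_int (height P) \<le> Q \<and>
           \<bar>eval_mpoly P x\<bar> \<le> \<epsilon> * Q powr (- real (N k CARD('n)))))"

definition k_algebraic :: "nat \<Rightarrow> real ^ 'n::finite \<Rightarrow> bool" where
  "k_algebraic k x \<longleftrightarrow>
     (\<exists>P :: 'n int_mpoly. P \<noteq> 0 \<and> eval_mpoly P x = 0 \<and> total_degree P = k)"

text \<open>
  The library constant \<open>algebraic\<close> concerns single field elements, hence the name.
  Allowing \<open>k = 0\<close> adds nothing: a nonzero constant has no zeros.
\<close>

definition algebraic_vector :: "real ^ 'n::finite \<Rightarrow> bool" where
  "algebraic_vector x \<longleftrightarrow> (\<exists>k. k_algebraic k x)"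

end

theory Submission imports Defs
begin

text \<open>
  Affine forms suffice for all degrees at once. A point \<open>x\<close> is the limit of nested balls around
  rational points \<open>p\<^sub>j\<close>, where a nonzero integer affine form \<open>P\<^sub>j\<close> of height at most \<open>H\<^sub>j\<close> vanishes
  at \<open>p\<^sub>j\<close>. As \<open>n \<ge> 2\<close>, some \<open>P\<^sub>j\<^sub>+\<^sub>1\<close> vanishes on a whole line through \<open>p\<^sub>j\<close>, and \<open>p\<^sub>j\<^sub>+\<^sub>1\<close> is chosen on
  this line so close to \<open>p\<^sub>j\<close> that \<open>\<bar>P\<^sub>j\<bar> \<le> 1 / H\<^sub>j\<^sub>+\<^sub>1 ^ j\<close> near it; then \<open>P\<^sub>j\<close> serves all \<open>Q\<close> with
  \<open>H\<^sub>j \<le> Q < H\<^sub>j\<^sub>+\<^sub>1\<close>. The line can be chosen not to lie in the zero set of a given nonzero function that is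
  polynomial on lines, so \<open>x\<close> avoids countably many such zero sets: those of all nonzero
  integer polynomials, and any countable set of points, via \<open>norm (x - c)\<^sup>2\<close>. Avoiding points
  gives uncountability.
\<close>

section \<open>Evaluation of integer polynomials and restriction to lines\<close>

lemma eval_mpoly_superset:
  assumes "finite K" "Poly_Mapping.keys P \<subseteq> K"
  shows "eval_mpoly P x =
    (\<Sum>m\<in>K. of_int (Poly_Mapping.lookup P m) * (\<Prod>i\<in>UNIV. (x $ i) ^ Poly_Mapping.lookup m i))"
  unfolding eval_mpoly_def using assms
  by (intro sum.mono_neutral_left) (auto simp: in_keys_iff)

lemma continuous_on_eval_mpoly: "continuous_on A (eval_mpoly P)"
  unfolding eval_mpoly_def by (intro continuous_intros)

text \<open>Shared by integer polynomials and squared distances to points: on each line such a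
  function is identically zero or has only finitely many zeros.\<close>

definition poly_on_lines :: "(real ^ 'n \<Rightarrow> real) \<Rightarrow> bool" where
  "poly_on_lines f \<longleftrightarrow> (\<forall>y v. \<exists>p. \<forall>t. f (y + t *\<^sub>R v) = poly p t)"

lemma poly_on_lines_eval_mpoly:
  fixes P :: "'n::finite int_mpoly"
  shows "poly_on_lines (eval_mpoly P)"
  unfolding poly_on_lines_def
proof (intro allI)
  fix y v :: "real ^ 'n"
  let ?p = "\<Sum>m\<in>Poly_Mapping.keys P. [:of_int (Poly_Mapping.lookup P m):] *
     (\<Prod>i\<in>UNIV. [:y $ i, v $ i:] ^ Poly_Mapping.lookup m i)"
  have "\<forall>t. eval_mpoly P (y + t *\<^sub>R v) = poly ?p t"
    by (simp add: eval_mpoly_def poly_sum poly_prod)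
  then show "\<exists>p. \<forall>t. eval_mpoly P (y + t *\<^sub>R v) = poly p t" ..
qed

lemma poly_on_lines_norm_diff:
  fixes c :: "real ^ 'n::finite"
  shows "poly_on_lines (\<lambda>x. (norm (x - c))\<^sup>2)"
  unfolding poly_on_lines_def
proof (intro allI)
  fix y v :: "real ^ 'n"
  have "(norm (y + t *\<^sub>R v - c))\<^sup>2 = poly [:(y - c) \<bullet> (y - c), 2 * ((y - c) \<bullet> v), v \<bullet> v:] t" for t
    by (simp add: power2_norm_eq_inner inner_simps algebra_simps inner_commute)
  then show "\<exists>p. \<forall>t. (norm (y + t *\<^sub>R v - c))\<^sup>2 = poly p t" by blast
qed

text \<open>On the line from \<open>p\<close> through \<open>x\<close> the function is a univariate
  polynomial with a whole interval of zeros, hence zero; the parameter 1 gives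
  \<open>x\<close>.\<close>

lemma poly_on_lines_eq_0_on_ball:
  assumes f: "poly_on_lines f" and "r > 0" and zero: "\<And>x. x \<in> ball p r \<Longrightarrow> f x = 0"
  shows "f x = 0"
proof (cases "x = p")
  case False
  obtain q where q: "\<And>t. f (p + t *\<^sub>R (x - p)) = poly q t"
    using f unfolding poly_on_lines_def by metis
  define d where "d = r / norm (x - p)"
  have "d > 0" using False \<open>r > 0\<close> by (simp add: d_def)
  have "poly q t = 0" if "t \<in> {0<..<d}" for t
  proof -
    have "p + t *\<^sub>R (x - p) \<in> ball p r"
      using that False by (simp add: dist_norm d_def pos_less_divide_eq)
    then show ?thesis using zero q by metis
  qed
  then have "{0<..<d} \<subseteq> {t. poly q t = 0}" by auto
  then have "q = 0"
    using \<open>d > 0\<close> poly_roots_finite[of q] finite_subset infinite_Ioo by metis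
  then show ?thesis using q[of 1] by simp
qed (use assms in auto)

section \<open>Rational points and integer affine forms\<close>

lemma rational_point_in_open:
  fixes U :: "(real ^ 'n) set"
  assumes "open U" "U \<noteq> {}"
  obtains z where "z \<in> U" "\<And>i. z $ i \<in> \<rat>"
proof -
  obtain x where x: "x \<in> U" using assms by auto
  then obtain e where e: "e > 0" "ball x e \<subseteq> U" using assms openE by blast
  define d where "d = e / real CARD('n)"
  have "d > 0" using e by (simp add: d_def)
  have "\<exists>q\<in>\<rat>. x $ i < q \<and> q < x $ i + d" for i
    by (rule Rats_dense_in_real) (use \<open>d > 0\<close> in simp)
  then obtain q where q: "\<And>i. q i \<in> \<rat>" "\<And>i. x $ i < q i" "\<And>i. q i < x $ i + d" by metis
  have "norm (x - (\<chi> i. q i)) \<le> (\<Sum>i\<in>UNIV. \<bar>(x - (\<chi> i. q i)) $ i\<bar>)"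
    by (rule norm_le_l1_cart)
  also have "\<dots> < (\<Sum>i\<in>(UNIV :: 'n set). d)"
  proof (rule sum_strict_mono)
    fix i show "\<bar>(x - (\<chi> i. q i)) $ i\<bar> < d" using q(2,3)[of i] by simp
  qed auto
  also have "\<dots> = e" by (simp add: d_def)
  finally show ?thesis using that[of "\<chi> i. q i"] e q by (auto simp: dist_norm)
qed

lemma clear_denominator:
  assumes "x \<in> \<rat>"
  obtains d :: int where "d > 0" "of_int d * x \<in> (\<int> :: real set)"
proof -
  from assms obtain a b where ab: "b > 0" "x = of_int a / of_int b"
    by (auto elim: Rats_cases')
  then have "of_int b * x = of_int a" by simp
  with ab(1) show ?thesis by (metis that Ints_of_int)
qed

text \<open>A form in two coordinates suffices: its linear part is orthogonal to the direction of
  the line in these coordinates, its constant term makes it vanish at \<open>p\<close>, and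
  rationality lets denominators be cleared. The case \<open>z = p\<close> is allowed and yields a
  form through a single point.\<close>

lemma integer_form_on_line:
  fixes p z :: "real ^ 'n::finite"
  assumes "CARD('n) \<ge> 2" and p: "\<And>i. p $ i \<in> \<rat>" and z: "\<And>i. z $ i \<in> \<rat>"
  obtains P :: "'n int_mpoly" where "P \<noteq> 0" "total_degree P \<le> 1"
    "\<And>t. eval_mpoly P (p + t *\<^sub>R (z - p)) = 0"
proof -
  obtain i j :: 'n where ij: "i \<noteq> j"
    using assms(1) card_le_Suc0_iff_eq[of "UNIV :: 'n set"] by fastforce
  define v where "v = z - p"
  have v: "v $ l \<in> \<rat>" for l by (simp add: v_def p z)
  \<comment> \<open>If both direction coordinates vanish, any linear part is orthogonal to them; the
    value 1 keeps the form nonzero.\<close>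
  define b0 c0 where "b0 = (if v $ i = 0 \<and> v $ j = 0 then 1 else v $ j)"
    and "c0 = - v $ i"
  define a0 where "a0 = - (b0 * p $ i + c0 * p $ j)"
  have rat: "b0 \<in> \<rat>" "c0 \<in> \<rat>" "a0 \<in> \<rat>" using p v by (auto simp: b0_def c0_def a0_def)
  have nz: "b0 \<noteq> 0 \<or> c0 \<noteq> 0" by (auto simp: b0_def c0_def)
  have dir: "b0 * v $ i + c0 * v $ j = 0" by (auto simp: b0_def c0_def)
  obtain da db dc :: int where d: "da > 0" "db > 0" "dc > 0"
    "of_int da * a0 \<in> \<int>" "of_int db * b0 \<in> \<int>" "of_int dc * c0 \<in> \<int>"
    using clear_denominator rat by metis
  define D where "D = da * db * dc"
  have D: "D > 0" using d by (simp add: D_def)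
  have "of_int D * a0 = of_int (db * dc) * (of_int da * a0)"
    "of_int D * b0 = of_int (da * dc) * (of_int db * b0)"
    "of_int D * c0 = of_int (da * db) * (of_int dc * c0)" by (simp_all add: D_def)
  then have "of_int D * a0 \<in> \<int>" "of_int D * b0 \<in> \<int>" "of_int D * c0 \<in> \<int>"
    using d by (metis Ints_mult Ints_of_int)+
  then obtain a b c :: int where abc: "of_int D * a0 = of_int a" "of_int D * b0 = of_int b"
    "of_int D * c0 = of_int c" by (metis Ints_cases)
  have bc: "b \<noteq> 0 \<or> c \<noteq> 0" using nz D abc by auto
  define e :: "'n \<Rightarrow> 'n \<Rightarrow>\<^sub>0 nat" where "e l = Poly_Mapping.single l 1" for l
  have look_e: "Poly_Mapping.lookup (e l) k = (if k = l then 1 else 0)" for l k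
    by (simp add: e_def lookup_single when_def)
  have e: "e i \<noteq> 0" "e j \<noteq> 0" "e i \<noteq> e j" "e j \<noteq> e i"
    using look_e ij by (metis lookup_zero zero_neq_one)+
  define P :: "'n int_mpoly" where
    "P = Poly_Mapping.single 0 a + Poly_Mapping.single (e i) b + Poly_Mapping.single (e j) c"
  have look: "Poly_Mapping.lookup P 0 = a" "Poly_Mapping.lookup P (e i) = b"
    "Poly_Mapping.lookup P (e j) = c"
    using e by (auto simp: P_def lookup_add lookup_single)
  have "P \<noteq> 0" using bc look by auto
  have keys: "Poly_Mapping.keys P \<subseteq> {0, e i, e j}"
    by (auto simp: P_def in_keys_iff lookup_add lookup_single when_def split: if_splits)
  have deg_e: "(\<Sum>k\<in>UNIV. Poly_Mapping.lookup (e l) k) = 1" for l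
    by (simp add: look_e)
  have "total_degree P \<le> 1"
    unfolding total_degree_def using keys deg_e by (subst Max_le_iff) auto
  have mono: "(\<Prod>k\<in>UNIV. (x $ k) ^ Poly_Mapping.lookup (e l) k) = x $ l" for x :: "real ^ 'n" and l
  proof -
    have "(\<Prod>k\<in>UNIV. (x $ k) ^ Poly_Mapping.lookup (e l) k) = (\<Prod>k\<in>UNIV. if k = l then x $ k else 1)"
      by (rule prod.cong) (auto simp: look_e)
    then show ?thesis by simp
  qed
  have ev: "eval_mpoly P x = of_int D * (a0 + b0 * x $ i + c0 * x $ j)" for x
    using e by (subst eval_mpoly_superset[OF _ keys])
      (simp_all add: look mono flip: abc, simp add: algebra_simps)
  have "eval_mpoly P (p + t *\<^sub>R (z - p)) = of_int D * (t * (b0 * v $ i + c0 * v $ j))" for t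
    by (simp add: ev a0_def v_def algebra_simps)
  then show ?thesis using that \<open>P \<noteq> 0\<close> \<open>total_degree P \<le> 1\<close> dir by simp
qed

section \<open>Nonvanishing and countability of integer polynomials\<close>

text \<open>Uniqueness of digits in base \<open>D\<close>: reduction mod \<open>D\<close> isolates
  the lowest digit, and induction treats the rest.\<close>

lemma positional_inj:
  fixes m m' :: "nat \<Rightarrow> nat"
  assumes "(\<Sum>i<n. m i * D ^ i) = (\<Sum>i<n. m' i * D ^ i)"
    and "\<And>i. i < n \<Longrightarrow> m i < D" "\<And>i. i < n \<Longrightarrow> m' i < D" and "i < n"
  shows "m i = m' i"
  using assms
proof (induction n arbitrary: m m' i)
  case (Suc n)
  have split: "(\<Sum>i<Suc n. g i * D ^ i) = g 0 + D * (\<Sum>i<n. g (Suc i) * D ^ i)" for g :: "nat \<Rightarrow> nat"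
    by (simp add: sum.lessThan_Suc_shift sum_distrib_left mult_ac del: sum.lessThan_Suc)
  have eq: "m 0 + D * (\<Sum>i<n. m (Suc i) * D ^ i) = m' 0 + D * (\<Sum>i<n. m' (Suc i) * D ^ i)"
    using Suc.prems(1) by (simp only: split)
  have lt: "m 0 < D" "m' 0 < D" using Suc.prems by auto
  have m0: "m 0 = m' 0" using arg_cong[OF eq, of "\<lambda>x. x mod D"] lt by simp
  with eq lt have "(\<Sum>i<n. m (Suc i) * D ^ i) = (\<Sum>i<n. m' (Suc i) * D ^ i)" by simp
  then have "m (Suc l) = m' (Suc l)" if "l < n" for l
    using Suc.IH[of "m \<circ> Suc" "m' \<circ> Suc" l] Suc.prems that by simp
  with m0 Suc.prems(4) show ?case by (cases i) auto
qed simp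

text \<open>Kronecker substitution \<open>x\<^sub>i = t ^ (D ^ i)\<close> turns distinct monomials into distinct powers of \<open>t\<close>.\<close>

lemma eval_mpoly_nonzero:
  fixes P :: "'n::finite int_mpoly"
  assumes "P \<noteq> 0"
  shows "\<exists>x. eval_mpoly P x \<noteq> 0"
proof -
  let ?K = "Poly_Mapping.keys P"
  obtain g :: "nat \<Rightarrow> 'n" where "bij_betw g {0..<CARD('n)} UNIV"
    using ex_bij_betw_nat_finite finite by blast
  then have g: "bij_betw g {..<CARD('n)} UNIV" by (simp add: atLeast0LessThan)
  \<comment> \<open>The base exceeds every exponent occurring in \<open>P\<close>, so exponents are
    valid digits and \<open>w\<close> reads an exponent vector as a number.\<close>
  define D where "D = Suc (Max ((\<lambda>(m, i). Poly_Mapping.lookup m i) ` (?K \<times> (UNIV :: 'n set))))"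
  have D: "Poly_Mapping.lookup m i < D" if "m \<in> ?K" for m i
    unfolding D_def less_Suc_eq_le by (rule Max_ge) (use that in force)+
  define w where "w m = (\<Sum>l<CARD('n). Poly_Mapping.lookup m (g l) * D ^ l)" for m :: "'n \<Rightarrow>\<^sub>0 nat"
  have inj: "inj_on w ?K"
  proof (rule inj_onI)
    fix m m' assume m: "m \<in> ?K" "m' \<in> ?K" "w m = w m'"
    have "Poly_Mapping.lookup m (g l) = Poly_Mapping.lookup m' (g l)" if "l < CARD('n)" for l
      using positional_inj[of "\<lambda>l. Poly_Mapping.lookup m (g l)" D "CARD('n)" "\<lambda>l. Poly_Mapping.lookup m' (g l)" l]
        m D that unfolding w_def by auto
    then have "Poly_Mapping.lookup m k = Poly_Mapping.lookup m' k" for k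
      using g by (metis UNIV_I bij_betw_def imageE lessThan_iff)
    then show "m = m'" by (intro poly_mapping_eqI)
  qed
  define q :: "real poly" where "q = (\<Sum>m\<in>?K. monom (of_int (Poly_Mapping.lookup P m)) (w m))"
  obtain m0 where m0: "m0 \<in> ?K" using assms by (metis all_not_in_conv keys_eq_empty)
  have "coeff q (w m0) = (\<Sum>m\<in>?K. if m = m0 then of_int (Poly_Mapping.lookup P m) else 0)"
    unfolding q_def coeff_sum coeff_monom by (rule sum.cong) (use inj m0 in \<open>auto dest: inj_onD\<close>)
  also have "\<dots> \<noteq> 0" using m0 by (simp add: in_keys_iff)
  finally have "q \<noteq> 0" by auto
  then obtain t where t: "poly q t \<noteq> 0" using poly_all_0_iff_0 by blast
  define x :: "real ^ 'n" where "x = (\<chi> i. t ^ (D ^ (inv_into {..<CARD('n)} g i)))"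
  have "(\<Prod>i\<in>UNIV. (x $ i) ^ Poly_Mapping.lookup m i) = t ^ w m" for m
  proof -
    have "(\<Prod>i\<in>UNIV. (x $ i) ^ Poly_Mapping.lookup m i)
        = (\<Prod>l<CARD('n). (x $ g l) ^ Poly_Mapping.lookup m (g l))"
      by (rule prod.reindex_bij_betw[OF g, symmetric])
    also have "\<dots> = (\<Prod>l<CARD('n). t ^ (Poly_Mapping.lookup m (g l) * D ^ l))"
      by (rule prod.cong) (use g in \<open>auto simp: x_def bij_betw_def mult.commute simp flip: power_mult\<close>)
    finally show ?thesis by (simp add: w_def power_sum)
  qed
  then have "eval_mpoly P x = poly q t"
    by (simp add: eval_mpoly_def q_def poly_sum poly_monom)
  with t show ?thesis by metis
qed

text \<open>A polynomial is determined by the finite graph of its nonzero coefficients, a finite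
  subset of a countable set.\<close>

lemma countable_int_mpoly: "countable (UNIV :: 'n::finite int_mpoly set)"
proof -
  have 1: "inj (Poly_Mapping.lookup :: ('n \<Rightarrow>\<^sub>0 nat) \<Rightarrow> _)" by (simp add: inj_def poly_mapping_eqI)
  have m: "countable (UNIV :: ('n \<Rightarrow>\<^sub>0 nat) set)"
    using countable_image_inj_on[OF _ 1] by blast
  let ?g = "\<lambda>P :: 'n int_mpoly. (\<lambda>m. (m, Poly_Mapping.lookup P m)) ` Poly_Mapping.keys P"
  have "inj ?g"
  proof (rule injI)
    fix P P' :: "'n int_mpoly" assume eq: "?g P = ?g P'"
    have mem: "(m, c) \<in> ?g Q \<longleftrightarrow> Poly_Mapping.lookup Q m = c \<and> c \<noteq> 0" for Q :: "'n int_mpoly" and m c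
      by (auto simp: in_keys_iff)
    have "Poly_Mapping.lookup P m = Poly_Mapping.lookup P' m" for m
      using mem[of m _ P] mem[of m _ P'] unfolding eq by metis
    then show "P = P'" by (intro poly_mapping_eqI)
  qed
  moreover have "countable (range ?g)"
  proof (rule countable_subset)
    show "range ?g \<subseteq> {A. finite A \<and> A \<subseteq> UNIV \<times> UNIV}" by auto
    show "countable {A. finite A \<and> A \<subseteq> (UNIV :: ('n \<Rightarrow>\<^sub>0 nat) set) \<times> (UNIV :: int set)}"
      by (intro countable_Collect_finite_subset countable_SIGMA m) auto
  qed
  ultimately show ?thesis by (rule countable_image_inj_on[rotated])
qed

section \<open>The nested ball construction\<close>

text \<open>
  The bound \<open>H\<close> on the height of the new form \<open>P'\<close> is fixed by the line through \<open>p\<close> and an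
  auxiliary rational point \<open>z\<close>; only then is the new centre \<open>p'\<close> moved along this line so close
  to \<open>p\<close> that the old form \<open>P\<close> is tiny in terms of \<open>H\<close>.
\<close>

lemma singular_step:
  fixes p :: "real ^ 'n::finite" and P :: "'n int_mpoly"
  assumes n: "CARD('n) \<ge> 2" and f: "poly_on_lines f" "continuous_on UNIV f" "f x0 \<noteq> 0"
    and p: "\<And>i. p $ i \<in> \<rat>" and Pp: "eval_mpoly P p = 0" and r: "r > 0"
  obtains p' P' H r' where "\<And>i. p' $ i \<in> \<rat>" "P' \<noteq> 0" "total_degree P' \<le> 1"
    "eval_mpoly P' p' = 0" "r' > 0" "H \<ge> real j + 1" "of_int (height P') \<le> H" "cball p' r' \<subseteq> ball p r"
    "\<And>x. x \<in> cball p' r' \<Longrightarrow> f x \<noteq> 0 \<and> \<bar>eval_mpoly P x\<bar> \<le> 1 / H ^ j"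
proof -
  have opf: "open {x. f x \<noteq> 0}"
    by (rule open_Collect_neq) (use f(2) in auto)
  moreover have "{x. f x \<noteq> 0} \<inter> ball p r \<noteq> {}"
    using poly_on_lines_eq_0_on_ball[OF f(1) r, of p x0] f(3) by blast
  ultimately obtain z where z: "f z \<noteq> 0" "z \<in> ball p r" "\<And>i. z $ i \<in> \<rat>"
    using rational_point_in_open[of "{x. f x \<noteq> 0} \<inter> ball p r"] by (auto intro: open_Int)
  obtain P' :: "'n int_mpoly" where P': "P' \<noteq> 0" "total_degree P' \<le> 1"
    "\<And>t. eval_mpoly P' (p + t *\<^sub>R (z - p)) = 0"
    using integer_form_on_line[OF n p z(3)] by metis
  define H where "H = max (real j + 1) (of_int (height P'))"
  have H: "H \<ge> real j + 1" "of_int (height P') \<le> H" "H > 0" by (auto simp: H_def)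
  define V where "V = {x. f x \<noteq> 0} \<inter> {x. \<bar>eval_mpoly P x\<bar> < 1 / H ^ j} \<inter> ball p r"
  have opW: "open {x. \<bar>eval_mpoly P x\<bar> < 1 / H ^ j}"
    by (intro open_Collect_less continuous_intros continuous_on_eval_mpoly)
  have opV: "open V" unfolding V_def by (intro open_Int opf opW open_ball)
  obtain q where q: "\<And>t. f (p + t *\<^sub>R (z - p)) = poly q t"
    using f(1) unfolding poly_on_lines_def by metis
  \<comment> \<open>The parameter 1 corresponds to \<open>z\<close>, where \<open>f\<close> is
    nonzero. The parameter 0 may still be a root, so \<open>d1\<close> only keeps the other roots
    away from 0.\<close>
  have "q \<noteq> 0" using q[of 1] z(1) by auto
  then obtain d1 where d1: "d1 > 0" "\<And>t. poly q t = 0 \<Longrightarrow> t \<noteq> 0 \<Longrightarrow> d1 \<le> dist 0 t"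
    using finite_set_avoid[OF poly_roots_finite, of q 0] by auto
  have "open ((\<lambda>t. p + t *\<^sub>R (z - p)) -` ({x. \<bar>eval_mpoly P x\<bar> < 1 / H ^ j} \<inter> ball p r))"
    by (intro open_vimage open_Int opW open_ball continuous_intros)
  \<comment> \<open>Continuity gives smallness of \<open>P\<close> near \<open>p\<close> because
    \<open>P\<close> vanishes at \<open>p\<close>.\<close>
  moreover have "0 \<in> (\<lambda>t. p + t *\<^sub>R (z - p)) -` ({x. \<bar>eval_mpoly P x\<bar> < 1 / H ^ j} \<inter> ball p r)"
    using Pp r H(3) by simp
  ultimately obtain d2 where d2: "d2 > 0"
    "ball 0 d2 \<subseteq> (\<lambda>t. p + t *\<^sub>R (z - p)) -` ({x. \<bar>eval_mpoly P x\<bar> < 1 / H ^ j} \<inter> ball p r)"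
    using openE by blast
  obtain t where t: "t \<in> \<rat>" "0 < t" "t < min d1 d2"
    using Rats_dense_in_real[of 0 "min d1 d2"] d1 d2 by auto
  define p' where "p' = p + t *\<^sub>R (z - p)"
  have "poly q t \<noteq> 0" using d1(2)[of t] t by auto
  moreover have "t \<in> ball 0 d2" using t by simp
  ultimately have "p' \<in> V" using d2(2) q by (auto simp: V_def p'_def)
  then obtain r' where r': "r' > 0" "cball p' r' \<subseteq> V" using opV open_contains_cball by metis
  have "p' $ i \<in> \<rat>" for i using t p z by (simp add: p'_def)
  then show ?thesis
    using that[of p' P' r' H] P' r' H unfolding V_def p'_def by force
qed

lemma exists_singular_avoiding:
  fixes f :: "nat \<Rightarrow> real ^ 'n::finite \<Rightarrow> real"
  assumes n: "CARD('n) \<ge> 2"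
    and f: "\<And>j. poly_on_lines (f j)" "\<And>j. continuous_on UNIV (f j)" "\<And>j. \<exists>x. f j x \<noteq> 0"
    and U: "open U" "U \<noteq> {}"
  shows "\<exists>x\<in>U. (\<forall>k\<ge>1. k_singular k x) \<and> (\<forall>j. f j x \<noteq> 0)"
proof -
  define good where "good = (\<lambda>(p :: real ^ 'n, P :: 'n int_mpoly, H :: real, r :: real).
    (\<forall>i. p $ i \<in> \<rat>) \<and> P \<noteq> 0 \<and> total_degree P \<le> 1 \<and> eval_mpoly P p = 0 \<and> r > 0 \<and>
    of_int (height P) \<le> H \<and> cball p r \<subseteq> U)"
  define step where "step = (\<lambda>j (p :: real ^ 'n, P :: 'n int_mpoly, H :: real, r :: real)
      (p' :: real ^ 'n, P' :: 'n int_mpoly, H' :: real, r' :: real).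
    H' \<ge> real j + 1 \<and> cball p' r' \<subseteq> ball p r \<and>
    (\<forall>x\<in>cball p' r'. f j x \<noteq> 0 \<and> \<bar>eval_mpoly P x\<bar> \<le> 1 / H' ^ j))"
  have "\<exists>s. \<forall>j. good (s j) \<and> step j (s j) (s (Suc j))"
  proof (rule dependent_nat_choice)
    obtain p where p: "p \<in> U" "\<And>i. p $ i \<in> \<rat>" using rational_point_in_open U by metis
    obtain r where r: "r > 0" "cball p r \<subseteq> U" using p U open_contains_cball by metis
    \<comment> \<open>The degenerate line through \<open>p\<close> and \<open>p\<close> supplies the
      initial form.\<close>
    obtain P :: "'n int_mpoly" where P: "P \<noteq> 0" "total_degree P \<le> 1"
      "\<And>t. eval_mpoly P (p + t *\<^sub>R (p - p)) = 0"
      using integer_form_on_line[OF n p(2) p(2)] by metis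
    have "good (p, P, of_int (height P), r)" using p r P by (simp add: good_def)
    then show "\<exists>s. good s" ..
  next
    fix s j assume "good s"
    obtain p P H r where s: "s = (p, P, H, r)" by (cases s)
    have g: "\<And>i. p $ i \<in> \<rat>" "eval_mpoly P p = 0" "r > 0" "cball p r \<subseteq> U"
      using \<open>good s\<close> by (auto simp: good_def s)
    obtain x0 where x0: "f j x0 \<noteq> 0" using f(3) by blast
    obtain p' P' H' r' where *: "\<And>i. p' $ i \<in> \<rat>" "P' \<noteq> 0" "total_degree P' \<le> 1"
      "eval_mpoly P' p' = 0" "r' > 0" "H' \<ge> real j + 1" "of_int (height P') \<le> H'"
      "cball p' r' \<subseteq> ball p r"
      "\<And>x. x \<in> cball p' r' \<Longrightarrow> f j x \<noteq> 0 \<and> \<bar>eval_mpoly P x\<bar> \<le> 1 / H' ^ j"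
      using singular_step[OF n f(1) f(2) x0 g(1-3), of j] by metis
    have "cball p' r' \<subseteq> U" using *(8) g(4) ball_subset_cball by blast
    with * have "good (p', P', H', r') \<and> step j s (p', P', H', r')"
      by (auto simp: good_def step_def s)
    then show "\<exists>s'. good s' \<and> step j s s'" ..
  qed
  then obtain s where s: "\<And>j. good (s j)" "\<And>j. step j (s j) (s (Suc j))" by blast
  define p P H r where "p j = fst (s j)" and "P j = fst (snd (s j))"
    and "H j = fst (snd (snd (s j)))" and "r j = snd (snd (snd (s j)))" for j
  have s_eq: "s j = (p j, P j, H j, r j)" for j
    by (simp add: p_def P_def H_def r_def)
  have good: "P j \<noteq> 0" "total_degree (P j) \<le> 1" "r j > 0" "of_int (height (P j)) \<le> H j"
    "cball (p j) (r j) \<subseteq> U" for j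
    using s(1)[of j] by (auto simp: good_def s_eq)
  have step: "H (Suc j) \<ge> real j + 1" "cball (p (Suc j)) (r (Suc j)) \<subseteq> ball (p j) (r j)"
    "x \<in> cball (p (Suc j)) (r (Suc j)) \<Longrightarrow> f j x \<noteq> 0"
    "x \<in> cball (p (Suc j)) (r (Suc j)) \<Longrightarrow> \<bar>eval_mpoly (P j) x\<bar> \<le> 1 / H (Suc j) ^ j" for j x
    using s(2)[of j] by (auto simp: step_def s_eq)
  have "cball (p (Suc j)) (r (Suc j)) \<subseteq> cball (p j) (r j)" for j
    using step(2) ball_subset_cball by blast
  then have decr: "cball (p j) (r j) \<subseteq> cball (p i) (r i)" if "i \<le> j" for i j
    using that by (rule lift_Suc_antimono_le[of "\<lambda>j. cball (p j) (r j)"])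
  have "(\<Inter>j. cball (p j) (r j)) \<noteq> {}"
    by (rule compact_nest) (use decr good(3) in \<open>auto simp: not_less intro: less_imp_le\<close>)
  then obtain x where "x \<in> (\<Inter>j. cball (p j) (r j))" by blast
  then have x: "x \<in> cball (p j) (r j)" for j by blast
  have small: "\<bar>eval_mpoly (P j) x\<bar> \<le> 1 / H (Suc j) ^ j" for j using step(4) x by blast
  have "k_singular k x" if "k \<ge> 1" for k
    unfolding k_singular_def
  proof (intro allI impI)
    fix \<epsilon> :: real assume eps: "\<epsilon> > 0"
    let ?N = "N k CARD('n)"
    \<comment> \<open>From stage \<open>J\<close> on, the exponent \<open>j\<close> is at least
      \<open>N + 1\<close>: \<open>N\<close> factors \<open>H l\<close> will beat
      \<open>Q ^ N\<close>, and one more absorbs \<open>1 / \<epsilon>\<close>.\<close>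
    define J where "J = max (Suc ?N) (nat \<lceil>1 / \<epsilon>\<rceil>)"
    define Q0 where "Q0 = Max (insert 1 (H ` {..J}))"
    have Q0: "Q0 \<ge> 1" "\<And>i. i \<le> J \<Longrightarrow> H i \<le> Q0" unfolding Q0_def by (auto intro!: Max_ge simp del: Max_insert)
    have "\<exists>R :: 'n int_mpoly. R \<noteq> 0 \<and> total_degree R \<le> k \<and> of_int (height R) \<le> Q \<and>
           \<bar>eval_mpoly R x\<bar> \<le> \<epsilon> * Q powr (- real ?N)" if Q: "Q > Q0" for Q
    proof -
      \<comment> \<open>The least \<open>l\<close> gives \<open>H (l - 1) \<le> Q < H l\<close>, so
        the form of stage \<open>l - 1\<close> is admissible for \<open>Q\<close>. It exists as
        \<open>H\<close> is unbounded, and \<open>Q > Q0\<close> forces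
        \<open>l > J\<close>.\<close>
      define l where "l = (LEAST l. Q < H l)"
      have "Q < H (Suc (nat \<lceil>Q\<rceil>))" using step(1)[of "nat \<lceil>Q\<rceil>"] by linarith
      then have l: "Q < H l" unfolding l_def by (rule LeastI)
      have "l > J" using Q0(2)[of l] l Q by (cases "l \<le> J") auto
      then obtain j where j: "l = Suc j" "j \<ge> J" by (cases l) auto
      have "\<not> Q < H j" using j not_less_Least[of j "\<lambda>l. Q < H l"] by (simp add: l_def)
      then have Hj: "of_int (height (P j)) \<le> Q" using good(4)[of j] by linarith
      have Qpos: "Q > 1" using Q Q0 by simp
      have H1: "H l \<ge> 1" using l Qpos by simp
      have "1 / \<epsilon> \<le> real J" unfolding J_def by linarith
      also have "\<dots> \<le> H l" using step(1)[of j] j by simp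
      finally have "1 \<le> \<epsilon> * H l" using eps by (simp add: field_simps)
      have "Q ^ ?N * 1 \<le> H l ^ ?N * (\<epsilon> * H l)"
        by (intro mult_mono power_mono \<open>1 \<le> \<epsilon> * H l\<close>) (use l Qpos H1 in auto)
      also have "\<dots> = \<epsilon> * H l ^ Suc ?N" by simp
      also have "\<dots> \<le> \<epsilon> * H l ^ j"
        by (intro mult_left_mono power_increasing) (use j H1 eps in \<open>auto simp: J_def\<close>)
      finally have "1 / H l ^ j \<le> \<epsilon> * (1 / Q ^ ?N)"
        using H1 Qpos by (simp add: field_simps)
      also have "1 / Q ^ ?N = Q powr (- real ?N)"
        using Qpos by (simp add: powr_minus powr_realpow divide_inverse)
      finally have "\<bar>eval_mpoly (P j) x\<bar> \<le> \<epsilon> * Q powr (- real ?N)"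
        using small[of j] j(1) by simp
      with Hj show ?thesis using good(1,2)[of j] \<open>k \<ge> 1\<close> le_trans by blast
    qed
    then show "\<exists>Q0>0. \<forall>Q>Q0. \<exists>R :: 'n int_mpoly. R \<noteq> 0 \<and> total_degree R \<le> k \<and>
        of_int (height R) \<le> Q \<and> \<bar>eval_mpoly R x\<bar> \<le> \<epsilon> * Q powr (- real ?N)"
      using Q0(1) by (intro exI[of _ Q0]) auto
  qed
  moreover have "x \<in> U" using x good(5) by blast
  moreover have "f j x \<noteq> 0" for j using step(3) x by blast
  ultimately show ?thesis by blast
qed

section \<open>Density and uncountability\<close>

text \<open>Both claims on the set follow from this: \<open>C = {}\<close> with arbitrary
  \<open>U\<close> gives density, and taking the whole set as \<open>C\<close> contradicts its
  countability.\<close>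

lemma exists_singular_transcendental:
  fixes U C :: "(real ^ 'n::finite) set"
  assumes n: "CARD('n) \<ge> 2" and U: "open U" "U \<noteq> {}" and C: "countable C"
  shows "\<exists>x\<in>U - C. (\<forall>k\<ge>1. k_singular k x) \<and> \<not> algebraic_vector x"
proof -
  define F where "F = eval_mpoly ` (- {0 :: 'n int_mpoly}) \<union> (\<lambda>c x. (norm (x - c))\<^sup>2) ` C"
  have cF: "countable F"
    unfolding F_def by (intro countable_Un countable_image C)
      (rule countable_subset[OF _ countable_int_mpoly], simp)
  \<comment> \<open>Nonemptiness of \<open>F\<close> is what makes \<open>from_nat_into F\<close>
    enumerate exactly \<open>F\<close>.\<close>
  have "eval_mpoly (1 :: 'n int_mpoly) \<in> F" by (simp add: F_def)
  then have F: "range (from_nat_into F) = F" using cF by (intro range_from_nat_into) auto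
  have "\<exists>x::real ^ 'n. norm (x - c) \<noteq> 0" for c
    by (rule exI[of _ "c + axis undefined 1"]) (simp add: axis_eq_0_iff)
  then have *: "poly_on_lines g \<and> continuous_on UNIV g \<and> (\<exists>x. g x \<noteq> 0)" if "g \<in> F" for g
    using that unfolding F_def
    by (auto simp: poly_on_lines_eval_mpoly poly_on_lines_norm_diff eval_mpoly_nonzero
        continuous_on_eval_mpoly intro!: continuous_intros)
  obtain x where x: "x \<in> U" "\<forall>k\<ge>1. k_singular k x" "\<And>j. from_nat_into F j x \<noteq> 0"
    using exists_singular_avoiding[OF n _ _ _ U, of "from_nat_into F"] * F by (metis rangeI)
  have nz: "g x \<noteq> 0" if "g \<in> F" for g using that x(3) F by (metis imageE)
  have "x \<notin> C"
  proof
    assume "x \<in> C"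
    then have "(\<lambda>y. (norm (y - x))\<^sup>2) \<in> F" by (auto simp: F_def)
    from nz[OF this] show False by simp
  qed
  moreover have "\<not> algebraic_vector x"
    using nz unfolding F_def algebraic_vector_def k_algebraic_def by auto
  ultimately show ?thesis using x by blast
qed

theorem theorem1p11:
  assumes "CARD('n::finite) \<ge> 2"
  shows "\<exists>S :: (real ^ 'n) set. closure S = UNIV \<and> uncountable S \<and>
           (\<forall>x\<in>S. (\<forall>k\<ge>1. k_singular k x) \<and> \<not> algebraic_vector x)"
proof -
  define S where "S = {x :: real ^ 'n. (\<forall>k\<ge>1. k_singular k x) \<and> \<not> algebraic_vector x}"
  have "closure S = UNIV"
  proof (rule ccontr)
    assume "closure S \<noteq> UNIV"
    then have "- closure S \<noteq> {}" by auto
    then obtain x where "x \<in> - closure S" "x \<in> S"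
      using exists_singular_transcendental[OF assms, of "- closure S" "{}"] unfolding S_def by auto
    then show False using closure_subset by blast
  qed
  moreover have "uncountable S"
  proof
    assume "countable S"
    from exists_singular_transcendental[OF assms open_UNIV _ this] show False
      unfolding S_def by blast
  qed
  ultimately show ?thesis unfolding S_def by blast
qed

end
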